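(* Let $\mathcal{G} = (N, U, \kappa)$ be a monotone submodular hedonic game with common ranking property (monotone submodular HGCRP). Then there exists a partition $\pi$ of $N$ into coalitions of size at most $\kappa$ that is simultaneously Nash stable, core stable and Pareto optimal.
   Context: A monotone submodular HGCRP instance is a triple $\mathcal{G} = (N, U, \kappa)$, where $N$ is a finite set of agents, $\kappa$ is a positive integer (upper bound on coalition sizes), and $U : 2^N \to \mathbb{R}$ is a joint utility function that is monotone ($U(X) \le U(Y)$ for all $X \subseteq Y \subseteq N$) and submodular ($U(X \cup \{x\}) - U(X) \ge U(Y \cup \{x\}) - U(Y)$ for all $X \subseteq Y \subseteq N$ and $x \in N \setminus Y$). A coalition is a nonempty subset of $N$ of size at most $\kappa$. A solution is a partition $\pi$ of $N$ into coalitions; all partitions considered are of this kind. For $i \in N$, $\pi(i)$ denotes the coalition of $\pi$ containing $i$, and the utility of agent $i$ in $\pi$ is $u_i(\pi) = U(\pi(i))$. A partition $\pi$ is Nash stable if for every agent $i \in N$ and every $C \in \pi$ with $|C| < \kappa$ we have $U(\pi(i)) \ge U(C \cup \{i\})$. (Moving to an empty coalition need not be considered, by monotonicity.) A coalition $C$ blocks $\pi$ if $U(C) > u_i(\pi)$ for all $i \in C$. A partition $\pi$ is core stable if no coalition blocks it. A partition $\pi'$ Pareto dominates $\pi$ if $u_i(\pi') \ge u_i(\pi)$ for all $i \in N$, with strict inequality for some $i$. A partition $\pi$ is Pareto optimal if no partition $\pi'$ Pareto dominates it. *)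

theory Defs
  imports Complex_Main "HOL-Library.Disjoint_Sets"
begin

definition submodular_on :: "'a set \<Rightarrow> ('a set \<Rightarrow> real) \<Rightarrow> bool" where
  "submodular_on N U \<longleftrightarrow>
     (\<forall>X Y. \<forall>x \<in> N - Y. X \<subseteq> Y \<and> Y \<subseteq> N \<longrightarrow>
        U (X \<union> {x}) - U X \<ge> U (Y \<union> {x}) - U Y)"

(* The joint utility function is total here, but only its values on subsets of N are constrained. *)
locale monotone_submodular_HGCRP =
  fixes N :: "'a set" and U :: "'a set \<Rightarrow> real" and \<kappa> :: nat
  assumes finite_agents: "finite N"
    and size_bound_pos: "\<kappa> > 0"
    and monotone_utility: "mono_on (Pow N) U"
    and submodular_utility: "submodular_on N U"

definition coalition :: "'a set \<Rightarrow> nat \<Rightarrow> 'a set \<Rightarrow> bool" where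
  "coalition N \<kappa> C \<longleftrightarrow> C \<noteq> {} \<and> C \<subseteq> N \<and> card C \<le> \<kappa>"

definition coalition_partition :: "'a set \<Rightarrow> nat \<Rightarrow> 'a set set \<Rightarrow> bool" where
  "coalition_partition N \<kappa> \<pi> \<longleftrightarrow> partition_on N \<pi> \<and> (\<forall>C\<in>\<pi>. coalition N \<kappa> C)"

(* Meaningful when \<pi> is a partition and i belongs to one of its members. *)
definition coalition_of :: "'a set set \<Rightarrow> 'a \<Rightarrow> 'a set" where
  "coalition_of \<pi> i = (THE C. C \<in> \<pi> \<and> i \<in> C)"

definition utility :: "('a set \<Rightarrow> real) \<Rightarrow> 'a set set \<Rightarrow> 'a \<Rightarrow> real" where
  "utility U \<pi> i = U (coalition_of \<pi> i)"

(* Only moves to nonempty coalitions are considered: by monotonicity, an agent never gains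
   by moving to the empty coalition. *)
definition nash_stable ::
    "'a set \<Rightarrow> ('a set \<Rightarrow> real) \<Rightarrow> nat \<Rightarrow> 'a set set \<Rightarrow> bool" where
  "nash_stable N U \<kappa> \<pi> \<longleftrightarrow>
     (\<forall>i\<in>N. \<forall>C\<in>\<pi>. card C < \<kappa> \<longrightarrow> utility U \<pi> i \<ge> U (C \<union> {i}))"

definition blocks :: "('a set \<Rightarrow> real) \<Rightarrow> 'a set \<Rightarrow> 'a set set \<Rightarrow> bool" where
  "blocks U C \<pi> \<longleftrightarrow> (\<forall>i\<in>C. U C > utility U \<pi> i)"

definition core_stable ::
    "'a set \<Rightarrow> ('a set \<Rightarrow> real) \<Rightarrow> nat \<Rightarrow> 'a set set \<Rightarrow> bool" where
  "core_stable N U \<kappa> \<pi> \<longleftrightarrow> \<not> (\<exists>C. coalition N \<kappa> C \<and> blocks U C \<pi>)"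

definition pareto_dominates ::
    "'a set \<Rightarrow> ('a set \<Rightarrow> real) \<Rightarrow> 'a set set \<Rightarrow> 'a set set \<Rightarrow> bool" where
  "pareto_dominates N U \<pi>' \<pi> \<longleftrightarrow>
     (\<forall>i\<in>N. utility U \<pi>' i \<ge> utility U \<pi> i) \<and> (\<exists>i\<in>N. utility U \<pi>' i > utility U \<pi> i)"

definition pareto_optimal ::
    "'a set \<Rightarrow> ('a set \<Rightarrow> real) \<Rightarrow> nat \<Rightarrow> 'a set set \<Rightarrow> bool" where
  "pareto_optimal N U \<kappa> \<pi> \<longleftrightarrow>
     \<not> (\<exists>\<pi>'. coalition_partition N \<kappa> \<pi>' \<and> pareto_dominates N U \<pi>' \<pi>)"

end

theory Submission
  imports Defs
begin

text \<open>
  Choose a partition whose utilities, listed in decreasing order, are lexicographically maximal.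
  Let a coalition \<open>S\<close> break away, cutting every other coalition \<open>D\<close> down to \<open>D - S\<close>. If some
  member of \<open>S\<close> gains, and every coalition losing members to \<open>S\<close> but not swallowed by it had
  utility less than \<open>U S\<close>, then the order strictly increases. A blocking coalition \<open>S\<close> and a
  profitable deviation to \<open>S = C \<union> {i}\<close> are both of this kind, and a Pareto improvement increases
  the order directly. The order is encoded by a sum of weights that grow by a factor
  \<open>card N + 1\<close> from each attainable utility to the next, so that one agent at a given level
  outweighs all agents below it.
\<close>

text \<open>Split \<open>N\<close> at the level \<open>u' i\<close>. Agents that start at or above
  it do not lose. Those below it, \<open>i\<close> among them, number at most \<open>card N\<close>,
  and their old weights together stay below the new weight of \<open>i\<close> alone, so nothing
  they lose can matter.\<close>

lemma sum_rank_power_less: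
  fixes u u' :: "'a \<Rightarrow> 'b::linorder"
  assumes fin: "finite N" "finite V"
    and V: "u ` N \<subseteq> V"
    and i: "i \<in> N" "u i < u' i"
    and no_loss: "\<And>j. j \<in> N \<Longrightarrow> u' i \<le> u j \<Longrightarrow> u j \<le> u' j"
  shows "(\<Sum>j\<in>N. Suc (card N) ^ card {v\<in>V. v < u j})
       < (\<Sum>j\<in>N. Suc (card N) ^ card {v\<in>V. v < u' j})"
proof -
  define w where "w v = Suc (card N) ^ card {x\<in>V. x < v}" for v
  define A where "A = {j\<in>N. u j < u' i}"
  have w_mono: "w x \<le> w y" if "x \<le> y" for x y
    unfolding w_def using that fin by (intro power_increasing card_mono) auto
  \<comment> \<open>Membership of \<open>x\<close> in \<open>V\<close> gives the extra factor:
    \<open>x\<close> is counted in the rank of \<open>y\<close> but not in its own.\<close>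
  have w_step: "Suc (card N) * w x \<le> w y" if "x \<in> V" "x < y" for x y
  proof -
    have "card {v\<in>V. v < x} < card {v\<in>V. v < y}"
      using that fin by (intro psubset_card_mono) auto
    then have "Suc (card N) ^ Suc (card {v\<in>V. v < x}) \<le> w y"
      unfolding w_def by (intro power_increasing) auto
    then show ?thesis by (simp add: w_def)
  qed
  have A: "A \<subseteq> N" "finite A" "i \<in> A"
    using fin i by (auto simp: A_def)
  have "(\<Sum>j\<in>A. Suc (card N) * w (u j)) \<le> (\<Sum>j\<in>A. w (u' i))"
    using V by (intro sum_mono w_step) (auto simp: A_def)
  also have "\<dots> \<le> card N * w (u' i)"
    using A fin by (simp add: card_mono)
  also have "\<dots> < Suc (card N) * w (u' i)"
    by (simp add: w_def)
  finally have "(\<Sum>j\<in>A. w (u j)) < w (u' i)"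
    by (simp only: sum_distrib_left [symmetric] mult_less_cancel1)
  also have "w (u' i) \<le> (\<Sum>j\<in>A. w (u' j))"
    using A by (intro member_le_sum) auto
  finally have "(\<Sum>j\<in>A. w (u j)) < (\<Sum>j\<in>A. w (u' j))" .
  moreover have "(\<Sum>j\<in>N - A. w (u j)) \<le> (\<Sum>j\<in>N - A. w (u' j))"
    by (intro sum_mono w_mono no_loss) (auto simp: A_def)
  ultimately have "(\<Sum>j\<in>N. w (u j)) < (\<Sum>j\<in>N. w (u' j))"
    using A fin by (simp add: sum.subset_diff [of A N])
  then show ?thesis by (simp add: w_def)
qed

text \<open>Coalitions swallowed by \<open>S\<close> leave an empty remainder, which a partition may
  not contain.\<close>

definition split_off :: "'a set \<Rightarrow> 'a set set \<Rightarrow> 'a set set" where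
  "split_off S \<pi> = insert S ((\<lambda>D. D - S) ` \<pi> - {{}})"

lemma partition_on_split_off:
  assumes "partition_on N \<pi>" "S \<subseteq> N" "S \<noteq> {}"
  shows "partition_on N (split_off S \<pi>)"
proof (rule partition_onI)
  show "\<Union> (split_off S \<pi>) = N"
    using assms by (auto simp: split_off_def partition_on_def)
  show "disjnt p q" if "p \<in> split_off S \<pi>" "q \<in> split_off S \<pi>" "p \<noteq> q" for p q
    using that partition_onD2 [OF assms(1)]
    by (fastforce simp: split_off_def disjnt_def disjoint_def)
  show "{} \<notin> split_off S \<pi>"
    using assms by (auto simp: split_off_def)
qed

lemma coalition_partition_split_off:
  assumes "finite N" "coalition_partition N \<kappa> \<pi>" "coalition N \<kappa> S"
  shows "coalition_partition N \<kappa> (split_off S \<pi>)"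
proof -
  have "coalition N \<kappa> (D - S)" if "D \<in> \<pi>" "D - S \<noteq> {}" for D
  proof -
    have "D \<subseteq> N" "card D \<le> \<kappa>"
      using that assms by (auto simp: coalition_partition_def coalition_def)
    moreover have "card (D - S) \<le> card D"
      using assms \<open>D \<subseteq> N\<close> by (meson Diff_subset card_mono finite_subset)
    ultimately show ?thesis
      using that by (auto simp: coalition_def)
  qed
  then have "\<forall>D\<in>split_off S \<pi>. coalition N \<kappa> D"
    using assms(3) by (auto simp: split_off_def)
  moreover have "partition_on N (split_off S \<pi>)"
    using assms by (auto simp: coalition_partition_def coalition_def intro: partition_on_split_off)
  ultimately show ?thesis
    by (simp add: coalition_partition_def)
qed

lemma coalition_partition_singletons:
  assumes "\<kappa> > 0"
  shows "coalition_partition N \<kappa> ((\<lambda>i. {i}) ` N)"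
  using assms by (auto simp: coalition_partition_def coalition_def partition_on_def disjoint_def)

lemma utility_eq:
  assumes "partition_on N \<pi>" "C \<in> \<pi>" "i \<in> C"
  shows "utility U \<pi> i = U C"
proof -
  have "coalition_of \<pi> i = C"
    unfolding coalition_of_def
    using assms partition_onD2 [OF assms(1)] by (intro the_equality) (auto simp: disjoint_def)
  then show ?thesis by (simp add: utility_def)
qed

lemma partition_on_obtain:
  assumes "partition_on N \<pi>" "i \<in> N"
  obtains D where "D \<in> \<pi>" "i \<in> D" "D \<subseteq> N"
  using assms by (auto simp: partition_on_def)

context monotone_submodular_HGCRP
begin

text \<open>Ranks are taken among all values of \<open>U\<close> on subsets of \<open>N\<close>, a
  finite set that does not depend on \<open>\<pi>\<close>, so potentials of different partitions are
  comparable.\<close>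

definition potential :: "'a set set \<Rightarrow> nat" where
  "potential \<pi> = (\<Sum>i\<in>N. Suc (card N) ^ card {v \<in> U ` Pow N. v < utility U \<pi> i})"

lemma potential_less:
  assumes "coalition_partition N \<kappa> \<pi>"
    and "i \<in> N" "utility U \<pi> i < utility U \<pi>' i"
    and "\<And>j. j \<in> N \<Longrightarrow> utility U \<pi>' i \<le> utility U \<pi> j \<Longrightarrow> utility U \<pi> j \<le> utility U \<pi>' j"
  shows "potential \<pi> < potential \<pi>'"
  unfolding potential_def
proof (rule sum_rank_power_less)
  have \<pi>: "partition_on N \<pi>"
    using assms(1) by (simp add: coalition_partition_def)
  show "utility U \<pi> ` N \<subseteq> U ` Pow N"
    using partition_on_obtain [OF \<pi>] utility_eq [OF \<pi>] by (smt (verit) PowI imageE imageI subsetI)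
qed (use assms finite_agents in auto)

text \<open>The one thing to check is that agents with old utility at least \<open>U S\<close> do
  not lose. By \<open>cut\<close>, the coalition of such an agent either lies inside
  \<open>S\<close>, where monotonicity helps, or is disjoint from \<open>S\<close> and survives
  intact.\<close>

lemma potential_less_split_off:
  assumes part: "coalition_partition N \<kappa> \<pi>"
    and S: "coalition N \<kappa> S"
    and i: "i \<in> S" "utility U \<pi> i < U S"
    and cut: "\<And>D. D \<in> \<pi> \<Longrightarrow> D \<inter> S \<noteq> {} \<Longrightarrow> \<not> D \<subseteq> S \<Longrightarrow> U D < U S"
  shows "potential \<pi> < potential (split_off S \<pi>)"
proof (rule potential_less [OF part])
  have \<pi>: "partition_on N \<pi>"
    using part by (simp add: coalition_partition_def)
  have "S \<subseteq> N" "S \<noteq> {}"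
    using S by (auto simp: coalition_def)
  note part' = partition_on_split_off [OF \<pi> this]
  have uS: "utility U (split_off S \<pi>) j = U S" if "j \<in> S" for j
    using that by (intro utility_eq [OF part']) (auto simp: split_off_def)
  show "i \<in> N"
    using i \<open>S \<subseteq> N\<close> by auto
  show "utility U \<pi> i < utility U (split_off S \<pi>) i"
    using i uS by simp
  show "utility U \<pi> j \<le> utility U (split_off S \<pi>) j"
    if "j \<in> N" and ge: "utility U (split_off S \<pi>) i \<le> utility U \<pi> j" for j
  proof -
    obtain D where D: "D \<in> \<pi>" "j \<in> D" "D \<subseteq> N"
      using \<pi> \<open>j \<in> N\<close> by (rule partition_on_obtain)
    have uD: "utility U \<pi> j = U D"
      using \<pi> D by (intro utility_eq)
    consider "D \<subseteq> S" | "D \<inter> S = {}"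
      using cut [of D] D ge uD uS i by fastforce
    then show ?thesis
    proof cases
      case 1
      then show ?thesis
        using uD uS D \<open>S \<subseteq> N\<close> mono_onD [OF monotone_utility, of D S] by auto
    next
      case 2
      then have "D = D - S" by auto
      then have "D \<in> split_off S \<pi>"
        using D by (auto simp: split_off_def)
      then show ?thesis
        using utility_eq [OF part'] D uD by simp
    qed
  qed
qed

lemma maximal_potential_core_stable:
  assumes part: "coalition_partition N \<kappa> \<pi>"
    and max: "\<And>\<pi>'. coalition_partition N \<kappa> \<pi>' \<Longrightarrow> potential \<pi>' \<le> potential \<pi>"
  shows "core_stable N U \<kappa> \<pi>"
  unfolding core_stable_def
proof
  assume "\<exists>S. coalition N \<kappa> S \<and> blocks U S \<pi>"
  then obtain S where S: "coalition N \<kappa> S" "\<And>i. i \<in> S \<Longrightarrow> utility U \<pi> i < U S"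
    by (auto simp: blocks_def)
  then obtain i where "i \<in> S"
    by (auto simp: coalition_def)
  have \<pi>: "partition_on N \<pi>"
    using part by (simp add: coalition_partition_def)
  have "potential \<pi> < potential (split_off S \<pi>)"
  proof (rule potential_less_split_off [OF part S(1) \<open>i \<in> S\<close>])
    \<comment> \<open>A common member of \<open>D\<close> and \<open>S\<close> has utility
      \<open>U D\<close> and gains strictly by blocking.\<close>
    show "U D < U S" if "D \<in> \<pi>" "D \<inter> S \<noteq> {}" for D
      using that S(2) utility_eq [OF \<pi> \<open>D \<in> \<pi>\<close>] by fastforce
  qed (use S \<open>i \<in> S\<close> in auto)
  then show False
    using max coalition_partition_split_off [OF finite_agents part S(1)] by (simp add: leD)
qed

text \<open>A move of \<open>i\<close> into \<open>C\<close> is treated as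
  \<open>C \<union> {i}\<close> breaking away: \<open>C\<close> is swallowed, so only the coalition
  that \<open>i\<close> leaves can be cut, and its utility is the one \<open>i\<close> improves
  on.\<close>

lemma maximal_potential_nash_stable:
  assumes part: "coalition_partition N \<kappa> \<pi>"
    and max: "\<And>\<pi>'. coalition_partition N \<kappa> \<pi>' \<Longrightarrow> potential \<pi>' \<le> potential \<pi>"
  shows "nash_stable N U \<kappa> \<pi>"
  unfolding nash_stable_def
proof (intro ballI impI, rule ccontr)
  fix i C
  assume i: "i \<in> N" and C: "C \<in> \<pi>" "card C < \<kappa>"
    and "\<not> U (C \<union> {i}) \<le> utility U \<pi> i"
  then have gain: "utility U \<pi> i < U (C \<union> {i})" by simp
  have \<pi>: "partition_on N \<pi>"
    using part by (simp add: coalition_partition_def)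
  have "C \<subseteq> N"
    using \<pi> C by (auto simp: partition_on_def)
  moreover have "card (C \<union> {i}) \<le> \<kappa>"
    using C card_Un_le [of C "{i}"] by simp
  ultimately have S: "coalition N \<kappa> (C \<union> {i})"
    using i by (simp add: coalition_def)
  have "potential \<pi> < potential (split_off (C \<union> {i}) \<pi>)"
  proof (rule potential_less_split_off [OF part S _ gain])
    fix D
    assume D: "D \<in> \<pi>" "D \<inter> (C \<union> {i}) \<noteq> {}" "\<not> D \<subseteq> C \<union> {i}"
    \<comment> \<open>\<open>D\<close> differs from \<open>C\<close>, hence is disjoint from it, and
      can meet \<open>C \<union> {i}\<close> only in \<open>i\<close>.\<close>
    then have "i \<in> D"
      using C partition_onD2 [OF \<pi>] by (auto simp: disjoint_def)
    then show "U D < U (C \<union> {i})"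
      using gain utility_eq [OF \<pi> \<open>D \<in> \<pi>\<close>] by simp
  qed simp
  then show False
    using max coalition_partition_split_off [OF finite_agents part S] by (simp add: leD)
qed

text \<open>Under Pareto dominance nobody loses, so any strict gainer can serve as the agent
  \<open>i\<close> of \<open>potential_less\<close>.\<close>

lemma maximal_potential_pareto_optimal:
  assumes part: "coalition_partition N \<kappa> \<pi>"
    and max: "\<And>\<pi>'. coalition_partition N \<kappa> \<pi>' \<Longrightarrow> potential \<pi>' \<le> potential \<pi>"
  shows "pareto_optimal N U \<kappa> \<pi>"
  using potential_less [OF part] max
  unfolding pareto_optimal_def pareto_dominates_def by (meson leD)

text \<open>A finite set has finitely many partitions, and the one into singletons is admissible
  since \<open>\<kappa> > 0\<close>.\<close>

lemma maximal_potential_exists: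
  obtains \<pi> where "coalition_partition N \<kappa> \<pi>"
    and "\<And>\<pi>'. coalition_partition N \<kappa> \<pi>' \<Longrightarrow> potential \<pi>' \<le> potential \<pi>"
proof -
  let ?P = "{\<pi>. coalition_partition N \<kappa> \<pi>}"
  have "finite ?P"
    by (rule finite_subset [OF _ finitely_many_partition_on [OF finite_agents]])
      (auto simp: coalition_partition_def)
  moreover have "?P \<noteq> {}"
    using coalition_partition_singletons [OF size_bound_pos] by auto
  ultimately obtain \<pi> where "\<pi> \<in> ?P" "Max (potential ` ?P) = potential \<pi>"
    using obtains_MAX by blast
  moreover have "potential \<pi>' \<le> Max (potential ` ?P)" if "\<pi>' \<in> ?P" for \<pi>'
    using \<open>finite ?P\<close> that by simp
  ultimately show thesis
    using that by simp
qed

end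

theorem theorem1:
  fixes N :: "'a set" and U :: "'a set \<Rightarrow> real" and \<kappa> :: nat
  assumes "monotone_submodular_HGCRP N U \<kappa>"
  shows "\<exists>\<pi>. coalition_partition N \<kappa> \<pi> \<and> nash_stable N U \<kappa> \<pi> \<and>
              core_stable N U \<kappa> \<pi> \<and> pareto_optimal N U \<kappa> \<pi>"
proof -
  interpret monotone_submodular_HGCRP N U \<kappa>
    by (fact assms)
  show ?thesis
    by (meson maximal_potential_exists maximal_potential_nash_stable
        maximal_potential_core_stable maximal_potential_pareto_optimal)
qed

end
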